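(* Consider the one-dimensional discontinuous Galerkin / summation by parts discretization of $-\partial_x^2\varphi=f$ in first-order form on elements $e=1,\dots,K$ described in the context, with numerical fluxes $\widehat{\varphi}=\{\!\{\varphi\}\!\}+\frac{\sqrt{T_r}}{2}[\![q]\!]$ and $\widehat{q}=\{\!\{q\}\!\}+\frac{1}{2\sqrt{T_r}}[\![\varphi]\!]$, $T_r>0$, at the interfaces between elements, and with periodic or weakly imposed Dirichlet boundary conditions. Assume that on every element a diagonal-norm SBP operator including the boundary nodes is used. Then the discrete gradient $q=(q_1,\dots,q_K)$ can be evaluated locally from $\varphi=(\varphi_1,\dots,\varphi_K)$, using from neighboring elements only surface values of $\varphi$ and $D\varphi$. That is: for every $\varphi$ there is exactly one $q$ satisfying the gradient equations $$q_e=D_e\varphi_e+M_e^{-1}t_{e,R}\left(\widehat{\varphi}_{e,R}-t_{e,R}^T\varphi_e\right)-M_e^{-1}t_{e,L}\left(\widehat{\varphi}_{e,L}-t_{e,L}^T\varphi_e\right),\qquad e=1,\dots,K,$$ (in which $\widehat{\varphi}$ itself depends on $q$), and for every element $e$ there is a function $F_e$, independent of $\varphi$, such that for all $\varphi$ the vector $q_e$ is given by $F_e$ applied to the following data only: (i) the vector $\varphi_e$ of the element itself; (ii) if $e$ has a left neighbor $e^-$, the two numbers $t_{e^-,R}^T\varphi_{e^-}$ and $t_{e^-,R}^TD_{e^-}\varphi_{e^-}$; (iii) if $e$ has a right neighbor $e^+$, the two numbers $t_{e^+,L}^T\varphi_{e^+}$ and $t_{e^+,L}^TD_{e^+}\varphi_{e^+}$;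 (iv) at a Dirichlet boundary point of $e$, the prescribed boundary value of $\varphi$. In particular, the operators of the discontinuous Galerkin spectral element method (DGSEM) with Gauss-Lobatto-Legendre nodes belong to this class of diagonal-norm SBP operators including the boundaries, so the result applies to DGSEM.
   Context: **Mesh and unknowns.** A bounded interval is divided into consecutive elements $e=1,\dots,K$, ordered from left to right, $e=(x_e,x_{e+1})$. On element $e$ there are $n_e\ge 2$ nodes in increasing order, the first and last of which are the left and right endpoints of the element. The unknowns on element $e$ are coefficient (nodal value) vectors $\varphi_e,q_e\in\mathbb{R}^{n_e}$, representing the potential and its gradient. The element $e^-=e-1$ is the left neighbor and $e^+=e+1$ the right neighbor of $e$ (indices taken modulo $K$ for periodic boundary conditions; for Dirichlet conditions element $1$ has no left neighbor and element $K$ has no right neighbor). **Diagonal-norm SBP operators including the boundaries.** On each element $e$ these consist of a discrete derivative matrix $D_e\in\mathbb{R}^{n_e\times n_e}$ (approximating $\partial_x$), a diagonal mass/norm matrix $M_e\in\mathbb{R}^{n_e\times n_e}$ with positive diagonal entries (approximating the $L^2$ inner product), and the boundary evaluation vectors $t_{e,L}=(1,0,\dots,0)^T$, $t_{e,R}=(0,\dots,0,1)^T$, satisfying the summation by parts (SBP) condition $$M_eD_e+(M_eD_e)^T=t_{e,R}t_{e,R}^T-t_{e,L}t_{e,L}^T.$$ DGSEM with polynomial degree $p\ge1$ uses on each element the $p+1$ Gauss-Lobatto-Legendre nodes (affinely mapped to the element), $D_e$ the matrix of differentiation of the Lagrange interpolation polynomials at these nodes, and $M_e$ the diagonal matrix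 of the (scaled) Gauss-Lobatto-Legendre quadrature weights. **Discretization.** The underlying weak form on each element, with test functions $\psi,\chi$, is $$\int_{x_e}^{x_{e+1}}q\,\partial_x\chi\,dx=\int_{x_e}^{x_{e+1}}f\chi\,dx+\left[\widehat q\,\chi\right]_{x_e}^{x_{e+1}},\qquad \int_{x_e}^{x_{e+1}}q\,\psi\,dx=-\int_{x_e}^{x_{e+1}}\varphi\,\partial_x\psi\,dx+\left[\widehat\varphi\,\psi\right]_{x_e}^{x_{e+1}}.$$ In the SBP framework it is written in the equivalent strong form $$q_e=D_e\varphi_e+M_e^{-1}t_{e,R}(\widehat\varphi_{e,R}-t_{e,R}^T\varphi_e)-M_e^{-1}t_{e,L}(\widehat\varphi_{e,L}-t_{e,L}^T\varphi_e),$$ $$-D_eq_e=f_e+M_e^{-1}t_{e,R}(\widehat q_{e,R}-t_{e,R}^Tq_e)-M_e^{-1}t_{e,L}(\widehat q_{e,L}-t_{e,L}^Tq_e),$$ where $f_e$ is the coefficient vector of $f$ and the subscripts $e,L$ and $e,R$ on a numerical flux denote its value at the left and right endpoint of $e$. The discrete gradient $q$ associated with $\varphi$ is defined by the first of these two equations. **Numerical fluxes.** At an interface between a left element $l$ and a right element $r$, for $u\in\{\varphi,q\}$, the mean and jump are $\{\!\{u\}\!\}=\frac12(t_{l,R}^Tu_l+t_{r,L}^Tu_r)$ and $[\![u]\!]=t_{r,L}^Tu_r-t_{l,R}^Tu_l$. The fluxes $\widehat\varphi=\{\!\{\varphi\}\!\}+\frac{\sqrt{T_r}}2[\![q]\!]$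 and $\widehat q=\{\!\{q\}\!\}+\frac1{2\sqrt{T_r}}[\![\varphi]\!]$ are single-valued at the interface, i.e. $\widehat\varphi_{l,R}=\widehat\varphi_{r,L}$ and $\widehat q_{l,R}=\widehat q_{r,L}$. Here $T_r>0$ is a fixed constant (relaxation time). For periodic boundary conditions the two endpoints of the domain are identified and form such an interface (with $l=K$, $r=1$). At a domain boundary point with a weakly imposed Dirichlet condition, $\widehat\varphi=\varphi^{\mathrm{boundary}}$ is the prescribed boundary value and $\widehat q=q^{\mathrm{interior}}+\frac{1}{2\sqrt{T_r}}[\![\varphi]\!]$, where $q^{\mathrm{interior}}$ is the value of $q$ at that point from the adjacent element and $[\![\varphi]\!]$ is the jump between the interior value and the boundary value; in particular $\widehat\varphi$ does not depend on $q$ there. *)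

theory Defs
  imports
    "HOL-Analysis.Henstock_Kurzweil_Integration"
    "HOL-Library.FuncSet"
    "HOL-Computational_Algebra.Polynomial"
    "Jordan_Normal_Form.Gauss_Jordan_Elimination"
begin

section \<open>Diagonal-norm SBP operators including the boundary nodes\<close>

definition trace_L :: "nat \<Rightarrow> real vec" where
  "trace_L n = unit_vec n 0"

definition trace_R :: "nat \<Rightarrow> real vec" where
  "trace_R n = unit_vec n (n - 1)"

definition outer_prod :: "real vec \<Rightarrow> real vec \<Rightarrow> real mat" where
  "outer_prod u v = Matrix.mat (dim_vec u) (dim_vec v) (\<lambda>(i, j). vec_index u i * vec_index v j)"

definition diagonal_norm_sbp :: "nat \<Rightarrow> real mat \<Rightarrow> real mat \<Rightarrow> bool" where
  "diagonal_norm_sbp n D M \<longleftrightarrow>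
     D \<in> carrier_mat n n \<and> M \<in> carrier_mat n n \<and>
     diagonal_mat M \<and> (\<forall>i<n. M $$ (i, i) > 0) \<and>
     M * D + transpose_mat (M * D) =
       outer_prod (trace_R n) (trace_R n) - outer_prod (trace_L n) (trace_L n)"

text \<open>\<open>xs\<close> lists the nodes of an element with endpoints \<open>a\<close> and \<open>b\<close>.\<close>

definition boundary_nodes :: "real \<Rightarrow> real \<Rightarrow> real list \<Rightarrow> bool" where
  "boundary_nodes a b xs \<longleftrightarrow>
     length xs \<ge> 2 \<and> sorted_wrt (<) xs \<and> hd xs = a \<and> last xs = b"


section \<open>The discretization\<close>

datatype boundary_condition = Periodic | Dirichlet

text \<open>
  The elements are \<open>1, \<dots>, num_elems\<close>, and element \<open>e\<close> is the interval from \<open>endpoint e\<close> to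
  \<open>endpoint (e + 1)\<close>. Values of the fields outside this index range are irrelevant.
\<close>

record discretization =
  num_elems :: nat
  endpoint :: "nat \<Rightarrow> real"
  nodes :: "nat \<Rightarrow> real list"
  deriv_mat :: "nat \<Rightarrow> real mat"
  mass_mat :: "nat \<Rightarrow> real mat"
  bc :: boundary_condition
  relax_time :: real

definition elems :: "discretization \<Rightarrow> nat set" where
  "elems S = {1..num_elems S}"

definition nnodes :: "discretization \<Rightarrow> nat \<Rightarrow> nat" where
  "nnodes S e = length (nodes S e)"

definition sbp_discretization :: "discretization \<Rightarrow> bool" where
  "sbp_discretization S \<longleftrightarrow>
     num_elems S \<ge> 1 \<and> relax_time S > 0 \<and>
     (\<forall>e\<in>elems S.
        endpoint S e < endpoint S (e + 1) \<and>
        boundary_nodes (endpoint S e) (endpoint S (e + 1)) (nodes S e) \<and>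
        diagonal_norm_sbp (nnodes S e) (deriv_mat S e) (mass_mat S e))"

text \<open>
  Coefficient families \<open>(u\<^sub>1, \<dots>, u\<^sub>K)\<close>; they are extensional functions, so that equality of
  families is equality on the elements.
\<close>

definition coeff_space :: "discretization \<Rightarrow> (nat \<Rightarrow> real vec) set" where
  "coeff_space S = (\<Pi>\<^sub>E e\<in>elems S. carrier_vec (nnodes S e))"

definition left_neighbor :: "discretization \<Rightarrow> nat \<Rightarrow> nat option" where
  "left_neighbor S e =
     (if e > 1 then Some (e - 1)
      else case bc S of Periodic \<Rightarrow> Some (num_elems S) | Dirichlet \<Rightarrow> None)"

definition right_neighbor :: "discretization \<Rightarrow> nat \<Rightarrow> nat option" where
  "right_neighbor S e =
     (if e < num_elems S then Some (e + 1)
      else case bc S of Periodic \<Rightarrow> Some 1 | Dirichlet \<Rightarrow> None)"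

definition val_L :: "discretization \<Rightarrow> nat \<Rightarrow> real vec \<Rightarrow> real" where
  "val_L S e v = trace_L (nnodes S e) \<bullet> v"

definition val_R :: "discretization \<Rightarrow> nat \<Rightarrow> real vec \<Rightarrow> real" where
  "val_R S e v = trace_R (nnodes S e) \<bullet> v"

definition mean :: "discretization \<Rightarrow> nat \<Rightarrow> nat \<Rightarrow> (nat \<Rightarrow> real vec) \<Rightarrow> real" where
  "mean S l r u = (val_R S l (u l) + val_L S r (u r)) / 2"

definition jump :: "discretization \<Rightarrow> nat \<Rightarrow> nat \<Rightarrow> (nat \<Rightarrow> real vec) \<Rightarrow> real" where
  "jump S l r u = val_L S r (u r) - val_R S l (u l)"

definition phi_flux ::
  "discretization \<Rightarrow> nat \<Rightarrow> nat \<Rightarrow> (nat \<Rightarrow> real vec) \<Rightarrow> (nat \<Rightarrow> real vec) \<Rightarrow> real" where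
  "phi_flux S l r \<phi> q = mean S l r \<phi> + sqrt (relax_time S) / 2 * jump S l r q"

text \<open>
  \<open>gL\<close> and \<open>gR\<close> are the Dirichlet values at the left and right end of the domain; they are not
  used for periodic boundary conditions.
\<close>

definition phi_flux_L ::
  "discretization \<Rightarrow> real \<Rightarrow> (nat \<Rightarrow> real vec) \<Rightarrow> (nat \<Rightarrow> real vec) \<Rightarrow> nat \<Rightarrow> real" where
  "phi_flux_L S gL \<phi> q e =
     (case left_neighbor S e of Some l \<Rightarrow> phi_flux S l e \<phi> q | None \<Rightarrow> gL)"

definition phi_flux_R ::
  "discretization \<Rightarrow> real \<Rightarrow> (nat \<Rightarrow> real vec) \<Rightarrow> (nat \<Rightarrow> real vec) \<Rightarrow> nat \<Rightarrow> real" where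
  "phi_flux_R S gR \<phi> q e =
     (case right_neighbor S e of Some r \<Rightarrow> phi_flux S e r \<phi> q | None \<Rightarrow> gR)"

definition inv_mass :: "discretization \<Rightarrow> nat \<Rightarrow> real mat" where
  "inv_mass S e = the (mat_inverse (mass_mat S e))"

definition discrete_gradient ::
  "discretization \<Rightarrow> real \<Rightarrow> real \<Rightarrow> (nat \<Rightarrow> real vec) \<Rightarrow> (nat \<Rightarrow> real vec) \<Rightarrow> bool" where
  "discrete_gradient S gL gR \<phi> q \<longleftrightarrow>
     (\<forall>e\<in>elems S.
        q e = deriv_mat S e *\<^sub>v \<phi> e
          + (phi_flux_R S gR \<phi> q e - val_R S e (\<phi> e)) \<cdot>\<^sub>v (inv_mass S e *\<^sub>v trace_R (nnodes S e))
          - (phi_flux_L S gL \<phi> q e - val_L S e (\<phi> e)) \<cdot>\<^sub>v (inv_mass S e *\<^sub>v trace_L (nnodes S e)))"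


section \<open>Local evaluation of the gradient\<close>

definition gradient_uniquely_determined :: "discretization \<Rightarrow> bool" where
  "gradient_uniquely_determined S \<longleftrightarrow>
     (\<forall>gL gR. \<forall>\<phi>\<in>coeff_space S. \<exists>!q. q \<in> coeff_space S \<and> discrete_gradient S gL gR \<phi> q)"

text \<open>
  The data entering through one side of an element: the surface values of \<open>\<phi>\<close> and \<open>D \<phi>\<close> of the
  neighbor if there is one, and the Dirichlet value otherwise.
\<close>

datatype side_data = Neighbor_Data real real | Dirichlet_Data real

definition left_data ::
  "discretization \<Rightarrow> real \<Rightarrow> (nat \<Rightarrow> real vec) \<Rightarrow> nat \<Rightarrow> side_data" where
  "left_data S gL \<phi> e = (case left_neighbor S e of
       Some l \<Rightarrow> Neighbor_Data (val_R S l (\<phi> l)) (val_R S l (deriv_mat S l *\<^sub>v \<phi> l))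
     | None \<Rightarrow> Dirichlet_Data gL)"

definition right_data ::
  "discretization \<Rightarrow> real \<Rightarrow> (nat \<Rightarrow> real vec) \<Rightarrow> nat \<Rightarrow> side_data" where
  "right_data S gR \<phi> e = (case right_neighbor S e of
       Some r \<Rightarrow> Neighbor_Data (val_L S r (\<phi> r)) (val_L S r (deriv_mat S r *\<^sub>v \<phi> r))
     | None \<Rightarrow> Dirichlet_Data gR)"

definition gradient_locally_computable :: "discretization \<Rightarrow> bool" where
  "gradient_locally_computable S \<longleftrightarrow>
     (\<forall>e\<in>elems S. \<exists>F :: real vec \<Rightarrow> side_data \<Rightarrow> side_data \<Rightarrow> real vec.
        \<forall>gL gR. \<forall>\<phi>\<in>coeff_space S. \<forall>q\<in>coeff_space S.
          discrete_gradient S gL gR \<phi> q \<longrightarrow>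
          q e = F (\<phi> e) (left_data S gL \<phi> e) (right_data S gR \<phi> e))"


section \<open>DGSEM with Gauss-Lobatto-Legendre nodes\<close>

text \<open>Rodrigues' formula.\<close>

definition legendre_poly :: "nat \<Rightarrow> real poly" where
  "legendre_poly n = Polynomial.smult (1 / (2 ^ n * fact n)) ((pderiv ^^ n) ([:-1, 0, 1:] ^ n))"

text \<open>The nodes on the reference interval \<open>[-1, 1]\<close> in increasing order, for \<open>p \<ge> 1\<close>.\<close>

definition gll_nodes :: "nat \<Rightarrow> real list" where
  "gll_nodes p = sorted_list_of_set ({-1, 1} \<union> {\<xi>. poly (pderiv (legendre_poly p)) \<xi> = 0})"

definition lagrange_basis :: "nat \<Rightarrow> real list \<Rightarrow> nat \<Rightarrow> real poly" where
  "lagrange_basis p xs j =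
     (\<Prod>k\<in>{..p} - {j}. Polynomial.smult (1 / (xs ! j - xs ! k)) [:- (xs ! k), 1:])"

definition gll_weight :: "nat \<Rightarrow> nat \<Rightarrow> real" where
  "gll_weight p i = integral {-1..1} (poly (lagrange_basis p (gll_nodes p) i))"

definition dgsem_nodes :: "nat \<Rightarrow> real \<Rightarrow> real \<Rightarrow> real list" where
  "dgsem_nodes p a b = map (\<lambda>\<xi>. a + (b - a) / 2 * (\<xi> + 1)) (gll_nodes p)"

definition dgsem_deriv :: "nat \<Rightarrow> real \<Rightarrow> real \<Rightarrow> real mat" where
  "dgsem_deriv p a b = Matrix.mat (p + 1) (p + 1)
     (\<lambda>(i, j). poly (pderiv (lagrange_basis p (dgsem_nodes p a b) j)) (dgsem_nodes p a b ! i))"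

definition dgsem_mass :: "nat \<Rightarrow> real \<Rightarrow> real \<Rightarrow> real mat" where
  "dgsem_mass p a b = mat_diag (p + 1) (\<lambda>i. (b - a) / 2 * gll_weight p i)"

definition dgsem ::
  "nat \<Rightarrow> nat \<Rightarrow> (nat \<Rightarrow> real) \<Rightarrow> boundary_condition \<Rightarrow> real \<Rightarrow> discretization" where
  "dgsem p K x c Tr = \<lparr>
     num_elems = K,
     endpoint = x,
     nodes = (\<lambda>e. dgsem_nodes p (x e) (x (e + 1))),
     deriv_mat = (\<lambda>e. dgsem_deriv p (x e) (x (e + 1))),
     mass_mat = (\<lambda>e. dgsem_mass p (x e) (x (e + 1))),
     bc = c,
     relax_time = Tr\<rparr>"

end

theory Submission
  imports Defs "HOL-Analysis.Equivalence_Lebesgue_Henstock_Integration"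
begin

text \<open>
  The mass matrix is diagonal and each element has at least two nodes, so the correction terms
  change only the two surface values of \<open>D \<phi>\<close>, each by a multiple of the flux at that endpoint.
  At an interface this turns the definition of \<open>\<phi>\<close>-hat into one scalar linear equation with a
  coefficient at least 1, whose solution involves only surface values of \<open>\<phi>\<close> and \<open>D \<phi>\<close>.

  For DGSEM, the Gauss-Lobatto-Legendre quadrature is exact up to degree \<open>2 p - 1\<close> by
  orthogonality, and the SBP property is exactness for the derivatives \<open>(l\<^sub>i l\<^sub>j)'\<close>.
\<close>

section \<open>Solving for the interface fluxes\<close>

text \<open>Unit vectors are eigenvectors of a diagonal matrix, hence of its inverse. Since
  \<open>inv_mass\<close> is \<open>the\<close> of an optional result, the diagonal matrix of
  reciprocals first certifies invertibility and so excludes \<open>None\<close>.\<close>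

lemma inv_mass_unit_vec:
  assumes M: "mass_mat S e \<in> carrier_mat n n" "diagonal_mat (mass_mat S e)"
    and pos: "\<forall>i<n. mass_mat S e $$ (i, i) > 0" and i: "i < n"
  shows "inv_mass S e *\<^sub>v unit_vec n i = (1 / mass_mat S e $$ (i, i)) \<cdot>\<^sub>v unit_vec n i"
proof -
  let ?M = "mass_mat S e"
  let ?W = "Matrix.mat n n (\<lambda>(i, j). if i = j then 1 / ?M $$ (i, i) else 0)"
  have Mdiag: "?M = mat_diag n (\<lambda>i. ?M $$ (i, i))"
    using M by (intro eq_matI) (auto simp: diagonal_mat_def mat_diag_def)
  have Wdiag: "?W = mat_diag n (\<lambda>i. 1 / ?M $$ (i, i))"
    by (intro eq_matI) (auto simp: mat_diag_def)
  have one: "mat_diag n (\<lambda>i. ?M $$ (i, i) * (1 / ?M $$ (i, i))) = 1\<^sub>m n"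
    "mat_diag n (\<lambda>i. 1 / ?M $$ (i, i) * ?M $$ (i, i)) = 1\<^sub>m n"
    using pos by (auto intro!: eq_matI simp: mat_diag_def less_le)
  have "?M * ?W = 1\<^sub>m n"
    using one(1) by (subst Mdiag, subst Wdiag, subst mat_diag_diag) simp
  moreover have "?W * ?M = 1\<^sub>m n"
    using one(2) by (subst (2) Mdiag, subst Wdiag, subst mat_diag_diag) simp
  ultimately have "?M \<in> Units (ring_mat TYPE(real) n ())"
    using M(1) by (auto simp: Units_def ring_mat_def intro!: bexI[of _ ?W])
  then obtain B where B: "mat_inverse ?M = Some B"
    using mat_inverse(1)[OF M(1), where b = "()"] by (cases "mat_inverse ?M") auto
  then have BM: "B * ?M = 1\<^sub>m n" "B \<in> carrier_mat n n"
    using mat_inverse(2)[OF M(1)] by auto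
  have Mi: "?M *\<^sub>v unit_vec n i = ?M $$ (i, i) \<cdot>\<^sub>v unit_vec n i"
    using M i by (intro eq_vecI) (auto simp: diagonal_mat_def)
  have "unit_vec n i = (B * ?M) *\<^sub>v unit_vec n i"
    using BM by simp
  also have "\<dots> = B *\<^sub>v (?M *\<^sub>v unit_vec n i)"
    using BM M by (intro assoc_mult_mat_vec) auto
  also have "\<dots> = ?M $$ (i, i) \<cdot>\<^sub>v (B *\<^sub>v unit_vec n i)"
    unfolding Mi using BM by (intro mult_mat_vec) auto
  finally have "unit_vec n i = ?M $$ (i, i) \<cdot>\<^sub>v (B *\<^sub>v unit_vec n i)" .
  then have "(1 / ?M $$ (i, i)) \<cdot>\<^sub>v unit_vec n i
      = (1 / ?M $$ (i, i)) \<cdot>\<^sub>v (?M $$ (i, i) \<cdot>\<^sub>v (B *\<^sub>v unit_vec n i))"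
    by (rule arg_cong)
  also have "\<dots> = B *\<^sub>v unit_vec n i"
    using pos i by (simp add: smult_smult_assoc less_le)
  finally show ?thesis
    unfolding inv_mass_def B by simp
qed

definition mass_L :: "discretization \<Rightarrow> nat \<Rightarrow> real" where
  "mass_L S e = mass_mat S e $$ (0, 0)"

definition mass_R :: "discretization \<Rightarrow> nat \<Rightarrow> real" where
  "mass_R S e = mass_mat S e $$ (nnodes S e - 1, nnodes S e - 1)"

text \<open>The fluxes at the left (\<open>a\<close>) and right (\<open>b\<close>) endpoint are free
  numbers here, which isolates the implicit dependence of the gradient equation on
  \<open>q\<close>.\<close>

definition flux_gradient :: "discretization \<Rightarrow> nat \<Rightarrow> real \<Rightarrow> real \<Rightarrow> real vec \<Rightarrow> real vec" where
  "flux_gradient S e a b v =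
     deriv_mat S e *\<^sub>v v
       + (b - val_R S e v) \<cdot>\<^sub>v (inv_mass S e *\<^sub>v trace_R (nnodes S e))
       - (a - val_L S e v) \<cdot>\<^sub>v (inv_mass S e *\<^sub>v trace_L (nnodes S e))"

lemma discrete_gradient_alt:
  "discrete_gradient S gL gR \<phi> q \<longleftrightarrow>
     (\<forall>e\<in>elems S. q e =
        flux_gradient S e (phi_flux_L S gL \<phi> q e) (phi_flux_R S gR \<phi> q e) (\<phi> e))"
  by (simp add: discrete_gradient_def flux_gradient_def)

text \<open>
  Inserting the surface values of the gradient equations into the definition of the numerical
  flux gives a scalar linear equation for the flux; this is its solution.
\<close>

definition interface_value ::
  "discretization \<Rightarrow> nat \<Rightarrow> nat \<Rightarrow> real \<Rightarrow> real \<Rightarrow> real \<Rightarrow> real \<Rightarrow> real" where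
  "interface_value S l r vl dl vr dr =
     ((vl + vr) / 2 + sqrt (relax_time S) / 2 * (dr - dl + vr / mass_L S r + vl / mass_R S l))
       / (1 + sqrt (relax_time S) / 2 * (1 / mass_L S r + 1 / mass_R S l))"

text \<open>\<open>the\<close> is harmless: \<open>left_data\<close> yields
  \<open>Neighbor_Data\<close> only if there is a left neighbor. The mass entry of that neighbor is
  a constant of \<open>S\<close>, not data of \<open>\<phi>\<close>.\<close>

definition flux_from_left :: "discretization \<Rightarrow> nat \<Rightarrow> real vec \<Rightarrow> side_data \<Rightarrow> real" where
  "flux_from_left S e v d = (case d of
       Neighbor_Data vl dl \<Rightarrow> interface_value S (the (left_neighbor S e)) e vl dl
         (val_L S e v) (val_L S e (deriv_mat S e *\<^sub>v v))
     | Dirichlet_Data g \<Rightarrow> g)"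

definition flux_from_right :: "discretization \<Rightarrow> nat \<Rightarrow> real vec \<Rightarrow> side_data \<Rightarrow> real" where
  "flux_from_right S e v d = (case d of
       Neighbor_Data vr dr \<Rightarrow> interface_value S e (the (right_neighbor S e))
         (val_R S e v) (val_R S e (deriv_mat S e *\<^sub>v v)) vr dr
     | Dirichlet_Data g \<Rightarrow> g)"

text \<open>\<open>local_gradient S e\<close> is the witness for \<open>F\<close> in
  \<open>gradient_locally_computable\<close>.\<close>

definition local_gradient ::
  "discretization \<Rightarrow> nat \<Rightarrow> real vec \<Rightarrow> side_data \<Rightarrow> side_data \<Rightarrow> real vec" where
  "local_gradient S e v dL dR =
     flux_gradient S e (flux_from_left S e v dL) (flux_from_right S e v dR) v"

section \<open>Gradient equations of a fixed SBP discretization\<close>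

context
  fixes S :: discretization
  assumes sbp: "sbp_discretization S"
begin

lemma sbp_element:
  assumes "e \<in> elems S"
  shows "nnodes S e \<ge> 2" "deriv_mat S e \<in> carrier_mat (nnodes S e) (nnodes S e)"
    "mass_mat S e \<in> carrier_mat (nnodes S e) (nnodes S e)" "diagonal_mat (mass_mat S e)"
    "\<forall>i<nnodes S e. mass_mat S e $$ (i, i) > 0"
  using sbp assms
  by (auto simp: sbp_discretization_def diagonal_norm_sbp_def boundary_nodes_def nnodes_def)

lemma mass_L_pos: "e \<in> elems S \<Longrightarrow> mass_L S e > 0"
  and mass_R_pos: "e \<in> elems S \<Longrightarrow> mass_R S e > 0"
  using sbp_element(1,5)[of e] by (auto simp: mass_L_def mass_R_def)

lemma inv_mass_trace:
  assumes "e \<in> elems S"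
  shows "inv_mass S e *\<^sub>v trace_L (nnodes S e) = (1 / mass_L S e) \<cdot>\<^sub>v trace_L (nnodes S e)"
    "inv_mass S e *\<^sub>v trace_R (nnodes S e) = (1 / mass_R S e) \<cdot>\<^sub>v trace_R (nnodes S e)"
  using sbp_element[OF assms] inv_mass_unit_vec[of S e "nnodes S e"]
  by (simp_all add: trace_L_def trace_R_def mass_L_def mass_R_def)

lemma val_index:
  assumes "e \<in> elems S" "v \<in> carrier_vec (nnodes S e)"
  shows "val_L S e v = vec_index v 0" "val_R S e v = vec_index v (nnodes S e - 1)"
  using sbp_element(1)[OF assms(1)] assms(2)
  by (auto simp: val_L_def val_R_def trace_L_def trace_R_def)

lemma flux_gradient_carrier:
  assumes "e \<in> elems S"
  shows "flux_gradient S e a b v \<in> carrier_vec (nnodes S e)"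
  \<comment> \<open>A vector sum or difference has the dimension of its last operand, here a
    multiple of \<open>trace_L\<close>.\<close>
  by (rule carrier_vecI) (simp add: flux_gradient_def inv_mass_trace[OF assms], simp add: trace_L_def)

text \<open>There are at least two nodes, so each surface value of the gradient sees one flux only.\<close>

lemma val_flux_gradient:
  assumes e: "e \<in> elems S" and v: "v \<in> carrier_vec (nnodes S e)"
  shows "val_L S e (flux_gradient S e a b v) =
           val_L S e (deriv_mat S e *\<^sub>v v) - (a - val_L S e v) / mass_L S e"
    and "val_R S e (flux_gradient S e a b v) =
           val_R S e (deriv_mat S e *\<^sub>v v) + (b - val_R S e v) / mass_R S e"
proof -
  have eq: "flux_gradient S e a b v = deriv_mat S e *\<^sub>v v
      + ((b - val_R S e v) / mass_R S e) \<cdot>\<^sub>v unit_vec (nnodes S e) (nnodes S e - 1)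
      - ((a - val_L S e v) / mass_L S e) \<cdot>\<^sub>v unit_vec (nnodes S e) 0"
    unfolding flux_gradient_def inv_mass_trace[OF e]
    by (simp add: trace_L_def trace_R_def smult_smult_assoc)
  have Dv: "deriv_mat S e *\<^sub>v v \<in> carrier_vec (nnodes S e)"
    using sbp_element(2)[OF e] v by auto
  show "val_L S e (flux_gradient S e a b v) =
           val_L S e (deriv_mat S e *\<^sub>v v) - (a - val_L S e v) / mass_L S e"
    unfolding val_index(1)[OF e flux_gradient_carrier[OF e]] val_index(1)[OF e Dv]
    using sbp_element(1,2)[OF e] Dv by (simp add: eq)
  show "val_R S e (flux_gradient S e a b v) =
           val_R S e (deriv_mat S e *\<^sub>v v) + (b - val_R S e v) / mass_R S e"
    unfolding val_index(2)[OF e flux_gradient_carrier[OF e]] val_index(2)[OF e Dv]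
    using sbp_element(1,2)[OF e] Dv by (simp add: eq)
qed

text \<open>\<open>x\<close> is a trial flux inserted into the gradient equations on both sides of
  the interface. The flux recomputed from them is affine in \<open>x\<close> with nonpositive slope,
  so it has exactly one fixed point. Keeping \<open>x\<close> arbitrary serves both a given solution
  and a candidate for one.\<close>

lemma phi_flux_eq_iff:
  assumes l: "l \<in> elems S" and r: "r \<in> elems S"
    and ql: "val_R S l (q l) = dl + (x - val_R S l (\<phi> l)) / mass_R S l"
    and qr: "val_L S r (q r) = dr - (x - val_L S r (\<phi> r)) / mass_L S r"
  shows "phi_flux S l r \<phi> q = x \<longleftrightarrow>
    x = interface_value S l r (val_R S l (\<phi> l)) dl (val_L S r (\<phi> r)) dr"
proof -
  let ?s = "sqrt (relax_time S) / 2" and ?a = "1 / mass_L S r" and ?b = "1 / mass_R S l"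
    and ?vl = "val_R S l (\<phi> l)" and ?vr = "val_L S r (\<phi> r)"
  have "?s \<ge> 0" "?a > 0" "?b > 0"
    using sbp mass_L_pos[OF r] mass_R_pos[OF l] by (auto simp: sbp_discretization_def)
  then have pos: "1 + ?s * (?a + ?b) > 0"
    by (intro add_pos_nonneg mult_nonneg_nonneg) auto
  have "phi_flux S l r \<phi> q =
      (?vl + ?vr) / 2 + ?s * ((dr - (x - ?vr) * ?a) - (dl + (x - ?vl) * ?b))"
    by (simp add: phi_flux_def mean_def jump_def ql qr)
  then have "phi_flux S l r \<phi> q = x \<longleftrightarrow>
      x * (1 + ?s * (?a + ?b)) = (?vl + ?vr) / 2 + ?s * (dr - dl + ?vr * ?a + ?vl * ?b)"
    by (auto simp: algebra_simps)
  also have "\<dots> \<longleftrightarrow> x = ((?vl + ?vr) / 2 + ?s * (dr - dl + ?vr * ?a + ?vl * ?b))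
      / (1 + ?s * (?a + ?b))"
    using pos by (subst nonzero_eq_divide_eq) auto
  finally show ?thesis
    by (simp add: interface_value_def)
qed

text \<open>Makes the fluxes single-valued: the two elements at an interface refer to the same pair
  \<open>l\<close>, \<open>r\<close>. A single periodic element is its own neighbor.\<close>

lemma neighbor_elems:
  assumes "e \<in> elems S"
  shows "left_neighbor S e = Some l \<Longrightarrow> l \<in> elems S \<and> right_neighbor S l = Some e"
    and "right_neighbor S e = Some r \<Longrightarrow> r \<in> elems S \<and> left_neighbor S r = Some e"
  using assms sbp
  by (auto simp: left_neighbor_def right_neighbor_def elems_def sbp_discretization_def
      split: if_splits boundary_condition.splits)

lemma coeff_space_carrier:
  "u \<in> coeff_space S \<Longrightarrow> e \<in> elems S \<Longrightarrow> u e \<in> carrier_vec (nnodes S e)"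
  by (auto simp: coeff_space_def PiE_iff)

text \<open>Replaces the implicit system by an explicit formula. Left to right gives uniqueness and
  locality, right to left gives existence.\<close>

lemma discrete_gradient_iff_local:
  assumes \<phi>: "\<phi> \<in> coeff_space S"
  shows "discrete_gradient S gL gR \<phi> q \<longleftrightarrow>
    (\<forall>e\<in>elems S. q e = local_gradient S e (\<phi> e) (left_data S gL \<phi> e) (right_data S gR \<phi> e))"
    (is "?lhs \<longleftrightarrow> ?rhs")
proof -
  note car = coeff_space_carrier[OF \<phi>]
  let ?fL = "\<lambda>e. flux_from_left S e (\<phi> e) (left_data S gL \<phi> e)"
  let ?fR = "\<lambda>e. flux_from_right S e (\<phi> e) (right_data S gR \<phi> e)"
  let ?I = "\<lambda>l r. interface_value S l r (val_R S l (\<phi> l)) (val_R S l (deriv_mat S l *\<^sub>v \<phi> l))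
                     (val_L S r (\<phi> r)) (val_L S r (deriv_mat S r *\<^sub>v \<phi> r))"
  \<comment> \<open>The two directions obtain the interface equation in different ways, so it is an
    assumption here.\<close>
  have fluxes: "phi_flux_L S gL \<phi> q e = ?fL e" "phi_flux_R S gR \<phi> q e = ?fR e"
    if e: "e \<in> elems S"
      and interface: "\<And>l r. l \<in> elems S \<Longrightarrow> r \<in> elems S \<Longrightarrow> right_neighbor S l = Some r \<Longrightarrow>
        left_neighbor S r = Some l \<Longrightarrow> phi_flux S l r \<phi> q = ?I l r" for e
    using neighbor_elems[OF e] interface e
    by (auto simp: phi_flux_L_def phi_flux_R_def flux_from_left_def flux_from_right_def
        left_data_def right_data_def split: option.splits)
  show ?thesis
  proof
    assume L: ?lhs
    have "phi_flux S l r \<phi> q = ?I l r"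
      if "l \<in> elems S" "r \<in> elems S"
        "right_neighbor S l = Some r" "left_neighbor S r = Some l" for l r
    \<comment> \<open>The trial value is the actual flux of \<open>q\<close>, for which the
      fixed-point equation is trivial.\<close>
    proof (subst phi_flux_eq_iff[symmetric, OF that(1,2)])
      have "q l = flux_gradient S l (phi_flux_L S gL \<phi> q l) (phi_flux S l r \<phi> q) (\<phi> l)"
        "q r = flux_gradient S r (phi_flux S l r \<phi> q) (phi_flux_R S gR \<phi> q r) (\<phi> r)"
        using L that by (auto simp: discrete_gradient_alt phi_flux_L_def phi_flux_R_def)
      then show
        "val_R S l (q l) = val_R S l (deriv_mat S l *\<^sub>v \<phi> l)
           + (phi_flux S l r \<phi> q - val_R S l (\<phi> l)) / mass_R S l"
        "val_L S r (q r) = val_L S r (deriv_mat S r *\<^sub>v \<phi> r)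
           - (phi_flux S l r \<phi> q - val_L S r (\<phi> r)) / mass_L S r"
        using val_flux_gradient car that(1,2) by metis+
    qed simp
    then show ?rhs
      using L fluxes by (auto simp: discrete_gradient_alt local_gradient_def)
  next
    assume R: ?rhs
    have "phi_flux S l r \<phi> q = ?I l r"
      if "l \<in> elems S" "r \<in> elems S"
        "right_neighbor S l = Some r" "left_neighbor S r = Some l" for l r
    \<comment> \<open>The trial value is now the closed form \<open>?I l r\<close>, so the explicit
      equation is the trivial one.\<close>
    proof (subst phi_flux_eq_iff[OF that(1,2)])
      have "q l = flux_gradient S l (?fL l) (?I l r) (\<phi> l)"
        "q r = flux_gradient S r (?I l r) (?fR r) (\<phi> r)"
        using R that by (auto simp: local_gradient_def flux_from_left_def flux_from_right_def
            left_data_def right_data_def)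
      then show
        "val_R S l (q l) = val_R S l (deriv_mat S l *\<^sub>v \<phi> l)
           + (?I l r - val_R S l (\<phi> l)) / mass_R S l"
        "val_L S r (q r) = val_L S r (deriv_mat S r *\<^sub>v \<phi> r)
           - (?I l r - val_L S r (\<phi> r)) / mass_L S r"
        using val_flux_gradient car that(1,2) by metis+
    qed simp
    then show ?lhs
      using R fluxes by (auto simp: discrete_gradient_alt local_gradient_def)
  qed
qed

lemma sbp_gradient_uniquely_determined: "gradient_uniquely_determined S"
  unfolding gradient_uniquely_determined_def
proof (intro allI ballI)
  fix gL gR \<phi>
  assume \<phi>: "\<phi> \<in> coeff_space S"
  \<comment> \<open>The restriction to \<open>elems S\<close> makes the witness extensional, as
    \<open>coeff_space\<close> demands.\<close>
  let ?g = "\<lambda>e\<in>elems S. local_gradient S e (\<phi> e) (left_data S gL \<phi> e) (right_data S gR \<phi> e)"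
  show "\<exists>!q. q \<in> coeff_space S \<and> discrete_gradient S gL gR \<phi> q"
  proof (rule ex1I[of _ ?g])
    show "?g \<in> coeff_space S \<and> discrete_gradient S gL gR \<phi> ?g"
      using flux_gradient_carrier
      by (auto simp: discrete_gradient_iff_local[OF \<phi>] coeff_space_def local_gradient_def)
  next
    fix q
    assume "q \<in> coeff_space S \<and> discrete_gradient S gL gR \<phi> q"
    then show "q = ?g"
      by (auto simp: discrete_gradient_iff_local[OF \<phi>] coeff_space_def PiE_iff
          extensional_def fun_eq_iff restrict_def)
  qed
qed

lemma sbp_gradient_locally_computable: "gradient_locally_computable S"
  unfolding gradient_locally_computable_def
  using discrete_gradient_iff_local by blast

end

section \<open>Real polynomials: Rolle, integration and Lagrange interpolation\<close>

text \<open>Rolle's theorem between consecutive zeros. The induction appends a new largest zero; the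
  new critical point lies beyond the old maximum and hence, by the range recorded in the conclusion,
  differs from the previous ones.\<close>

lemma Rolle_card:
  fixes f :: "real poly"
  assumes "finite A" "A \<noteq> {}" "\<forall>x\<in>A. poly f x = 0"
  shows "\<exists>B. finite B \<and> Suc (card B) = card A \<and> B \<subseteq> {Min A<..<Max A} \<and>
           (\<forall>x\<in>B. poly (pderiv f) x = 0)"
  using assms
proof (induction A rule: finite_linorder_max_induct)
  case (insert b A)
  show ?case
  proof (cases "A = {}")
    case True
    then show ?thesis by (intro exI[of _ "{}"]) auto
  next
    case False
    then obtain B where B: "finite B" "Suc (card B) = card A" "B \<subseteq> {Min A<..<Max A}"
      "\<forall>x\<in>B. poly (pderiv f) x = 0"
      using insert by auto
    have M: "Max A \<in> A" "Max A < b" "b \<notin> A" "Min A \<le> Max A" "Min A \<in> A"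
      using insert False by auto
    obtain z where z: "Max A < z" "z < b" "poly (pderiv f) z = 0"
      using poly_MVT[OF M(2), of f] insert.prems M by auto
    have "Min (insert b A) = Min A" "Max (insert b A) = b"
      unfolding Min_insert[OF insert(1) False] Max_insert[OF insert(1) False] using M by auto
    moreover have "insert z B \<subseteq> {Min A<..<b}"
      using B(3) z(1,2) M(2,4) by fastforce
    moreover have "z \<notin> B" using B(3) z(1) by auto
    ultimately show ?thesis
      using B(1,2,4) z(3) M(3) insert(1) by (intro exI[of _ "insert z B"]) simp
  qed
qed simp

section \<open>Integrals of polynomials\<close>

lemma poly_integrable: "poly (f :: real poly) integrable_on {a..b}"
  by (intro integrable_continuous_interval continuous_intros)

lemma integral_poly_0 [simp]: "integral {a..b} (poly (0 :: real poly)) = 0"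
proof -
  have "poly (0 :: real poly) = (\<lambda>_. 0)" by auto
  then show ?thesis by simp
qed

lemma integral_poly_add:
  fixes f g :: "real poly"
  shows "integral {a..b} (poly (f + g)) = integral {a..b} (poly f) + integral {a..b} (poly g)"
  using integral_add[OF poly_integrable[of f] poly_integrable[of g]] by (simp add: poly_add[abs_def])

lemma integral_poly_smult:
  "integral {a..b} (poly (Polynomial.smult c f)) = c * integral {a..b} (poly (f :: real poly))"
proof -
  have "poly (Polynomial.smult c f) = (\<lambda>x. c * poly f x)" by auto
  then show ?thesis by simp
qed

lemma integral_poly_sum:
  "finite I \<Longrightarrow> integral {a..b} (poly (\<Sum>i\<in>I. f i :: real poly)) = (\<Sum>i\<in>I. integral {a..b} (poly (f i)))"
proof -
  assume "finite I"
  moreover have "poly (\<Sum>i\<in>I. f i) = (\<lambda>x. \<Sum>i\<in>I. poly (f i) x)" by (auto simp: poly_sum)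
  ultimately show ?thesis by (simp add: integral_sum poly_integrable)
qed

lemma integral_poly_pderiv:
  assumes "a \<le> b"
  shows "integral {a..b} (poly (pderiv f)) = poly f b - poly f (a :: real)"
  using assms
  by (intro integral_unique fundamental_theorem_of_calculus)
    (auto simp flip: has_real_derivative_iff_has_vector_derivative intro: has_field_derivative_at_within)

lemma integral_poly_by_parts:
  assumes "a \<le> b" "poly (f * g) a = 0" "poly (f * g) b = (0 :: real)"
  shows "integral {a..b} (poly (pderiv f * g)) = - integral {a..b} (poly (f * pderiv g))"
proof -
  have "pderiv f * g + f * pderiv g = pderiv (f * g)"
    by (simp add: pderiv_mult algebra_simps)
  then have "integral {a..b} (poly (pderiv f * g)) + integral {a..b} (poly (f * pderiv g)) = 0"
    using integral_poly_pderiv[OF assms(1), of "f * g"] assms(2,3)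
    by (simp only: integral_poly_add[symmetric])
  then show ?thesis by simp
qed

section \<open>Lagrange interpolation\<close>

lemma
  fixes xs :: "real list"
  assumes xs: "distinct xs" "length xs = Suc p" and j: "j \<le> p"
  shows poly_lagrange_basis: "i \<le> p \<Longrightarrow> poly (lagrange_basis p xs j) (xs ! i) = (if i = j then 1 else 0)"
    and degree_lagrange_basis: "degree (lagrange_basis p xs j) = p"
proof -
  have ne: "xs ! k \<noteq> xs ! j" if "k \<le> p" "k \<noteq> j" for k
    using xs j that by (simp add: nth_eq_iff_index_eq)
  show "poly (lagrange_basis p xs j) (xs ! i) = (if i = j then 1 else 0)" if "i \<le> p"
  proof (cases "i = j")
    case True
    have "poly (Polynomial.smult (1 / (xs ! j - xs ! k)) [:- (xs ! k), 1:]) (xs ! j) = 1"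
      if "k \<in> {..p} - {j}" for k
      using ne[of k] that by (simp flip: diff_divide_distrib)
    then show ?thesis
      using True unfolding lagrange_basis_def poly_prod by (simp only: prod.neutral_const cong: prod.cong) simp
  next
    case False
    then show ?thesis
      using that by (auto simp: lagrange_basis_def poly_prod intro!: prod_zero)
  qed
  show "degree (lagrange_basis p xs j) = p"
  proof -
    have "Polynomial.smult (1 / (xs ! j - xs ! k)) [:- (xs ! k), 1:] \<noteq> 0"
      "degree (Polynomial.smult (1 / (xs ! j - xs ! k)) [:- (xs ! k), 1:]) = 1"
      if "k \<in> {..p} - {j}" for k
      using ne[of k] that by auto
    then show ?thesis
      using j unfolding lagrange_basis_def by (subst degree_prod_sum_eq) simp_all
  qed
qed

text \<open>Both sides have degree at most \<open>p\<close> and agree at \<open>p + 1\<close>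
  distinct points.\<close>

lemma lagrange_interpolation:
  fixes f :: "real poly"
  assumes xs: "distinct xs" "length xs = Suc p" and f: "degree f \<le> p"
  shows "f = (\<Sum>j\<le>p. Polynomial.smult (poly f (xs ! j)) (lagrange_basis p xs j))" (is "_ = ?g")
proof (rule poly_eqI_degree[where A = "set xs"])
  have "degree ?g \<le> p"
    by (intro degree_sum_le) (auto intro: order.trans[OF degree_smult_le] simp: degree_lagrange_basis[OF xs])
  then show "degree ?g < card (set xs)" "degree f < card (set xs)"
    using xs f by (auto simp: distinct_card)
next
  fix x assume "x \<in> set xs"
  then obtain i where i: "i \<le> p" "x = xs ! i"
    using xs(2) by (auto simp: in_set_conv_nth less_Suc_eq_le)
  have "poly ?g x = (\<Sum>j\<le>p. if i = j then poly f (xs ! j) else 0)"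
    unfolding poly_sum i(2) by (intro sum.cong) (auto simp: poly_lagrange_basis[OF xs] i(1))
  then show "poly f x = poly ?g x" using i by simp
qed

text \<open>Transfers the basis from an element to the reference interval: in each linear factor the
  \<open>h\<close> from the substitution cancels the \<open>h\<close> in the node
  difference.\<close>

lemma lagrange_basis_affine:
  fixes xs :: "real list"
  assumes h: "h \<noteq> 0" and xs: "length xs = Suc p" and j: "j \<le> p"
  shows "pcompose (lagrange_basis p (map (\<lambda>\<xi>. a + h * (\<xi> + 1)) xs) j) [:a + h, h:] = lagrange_basis p xs j"
  unfolding lagrange_basis_def pcompose_prod
proof (intro prod.cong refl)
  fix k assume "k \<in> {..p} - {j}"
  then have nth: "map (\<lambda>\<xi>. a + h * (\<xi> + 1)) xs ! j = a + h * (xs ! j + 1)"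
    "map (\<lambda>\<xi>. a + h * (\<xi> + 1)) xs ! k = a + h * (xs ! k + 1)"
    using xs j by simp_all
  have d: "a + h * (xs ! j + 1) - (a + h * (xs ! k + 1)) = h * (xs ! j - xs ! k)"
    and c: "[:- (a + h * (xs ! k + 1)), 1:] \<circ>\<^sub>p [:a + h, h:] = Polynomial.smult h [:- (xs ! k), 1:]"
    by (simp_all add: pcompose_pCons algebra_simps)
  let ?ys = "map (\<lambda>\<xi>. a + h * (\<xi> + 1)) xs"
  show "Polynomial.smult (1 / (?ys ! j - ?ys ! k)) [:- (?ys ! k), 1:] \<circ>\<^sub>p [:a + h, h:]
      = Polynomial.smult (1 / (xs ! j - xs ! k)) [:- (xs ! k), 1:]"
    unfolding nth pcompose_smult d c using h by (simp only: smult_smult) simp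
qed

section \<open>Legendre polynomials and Gauss-Lobatto-Legendre quadrature\<close>

abbreviation x2m1 :: "real poly" where
  "x2m1 \<equiv> [:-1, 0, 1:]"

lemma power_dvd_pderiv:
  fixes q f :: "'a :: idom poly"
  assumes "q ^ Suc m dvd f"
  shows "q ^ m dvd pderiv f"
proof -
  from assms obtain g where g: "f = q ^ Suc m * g" by (rule dvdE)
  have "pderiv f = q ^ m * (q * pderiv g + Polynomial.smult (of_nat (Suc m)) (pderiv q) * g)"
    unfolding g pderiv_mult pderiv_power_Suc by (simp add: distrib_left mult_ac)
  then show ?thesis by simp
qed

text \<open>Each derivative costs at most one of the \<open>n\<close> factors \<open>x2m1\<close>,
  so one is left after \<open>k < n\<close> derivatives.\<close>

lemma rodrigues_endpoint:
  assumes "k < n" "x = 1 \<or> x = -1"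
  shows "poly ((pderiv ^^ k) (x2m1 ^ n)) x = 0"
proof -
  have "x2m1 ^ (n - k) dvd (pderiv ^^ k) (x2m1 ^ n)" if "k \<le> n" for k
    using that
  proof (induction k)
    case (Suc k)
    then have "x2m1 ^ Suc (n - Suc k) dvd (pderiv ^^ k) (x2m1 ^ n)"
      by (simp add: Suc_diff_Suc del: power_Suc)
    then show ?case using power_dvd_pderiv by (simp del: power_Suc)
  qed simp
  then have "x2m1 dvd (pderiv ^^ k) (x2m1 ^ n)"
    using assms(1) by (meson dvd_power dvd_trans less_imp_le zero_less_diff)
  moreover have "poly x2m1 x = 0" using assms(2) by auto
  ultimately show ?thesis by (metis dvdE poly_mult mult_zero_left)
qed

text \<open>Together with the endpoint zeros, \<open>k\<close> interior zeros make
  \<open>k + 2\<close>, between which Rolle's theorem finds \<open>k + 1\<close> interior zeros of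
  the next derivative.\<close>

lemma rodrigues_roots:
  assumes "k \<le> n"
  shows "\<exists>A. finite A \<and> card A = k \<and> A \<subseteq> {-1<..<1} \<and> (\<forall>x\<in>A. poly ((pderiv ^^ k) (x2m1 ^ n)) x = 0)"
  using assms
proof (induction k)
  case 0
  then show ?case by (intro exI[of _ "{}"]) auto
next
  case (Suc k)
  then obtain A where A: "finite A" "card A = k" "A \<subseteq> {-1<..<1}"
    "\<forall>x\<in>A. poly ((pderiv ^^ k) (x2m1 ^ n)) x = 0" by auto
  let ?A = "insert (-1) (insert 1 A)"
  have "card ?A = k + 2" using A by (auto simp: card_insert_if)
  moreover have "\<forall>x\<in>?A. poly ((pderiv ^^ k) (x2m1 ^ n)) x = 0"
    using A(4) Suc.prems rodrigues_endpoint[of k n] by auto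
  moreover have "Min ?A = -1"
    using A(1,3) by (intro Min_eqI) force+
  moreover have "Max ?A = 1"
    using A(1,3) by (intro Max_eqI) force+
  ultimately show ?case
    using Rolle_card[of ?A "(pderiv ^^ k) (x2m1 ^ n)"] A(1) by auto
qed

lemma degree_legendre: "degree (legendre_poly n) = n"
  by (simp add: legendre_poly_def degree_higher_pderiv degree_power_eq)

text \<open>Rolle's theorem on the \<open>p\<close> interior zeros of the Legendre polynomial gives
  \<open>p - 1\<close> zeros of its derivative; the degree of the derivative allows no
  others.\<close>

lemma legendre_deriv_roots:
  assumes "p \<ge> 1"
  defines "R \<equiv> {\<xi>. poly (pderiv (legendre_poly p)) \<xi> = 0}"
  shows "finite R" "card R = p - 1" "R \<subseteq> {-1<..<1}"
proof -
  obtain A where A: "finite A" "card A = p" "A \<subseteq> {-1<..<1}"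
    "\<forall>x\<in>A. poly ((pderiv ^^ p) (x2m1 ^ p)) x = 0"
    using rodrigues_roots[of p p] by auto
  then have "A \<noteq> {}" "\<forall>x\<in>A. poly (legendre_poly p) x = 0"
    using assms(1) by (auto simp: legendre_poly_def)
  from Rolle_card[OF A(1) this] obtain B where B: "finite B" "Suc (card B) = p"
    "B \<subseteq> {Min A<..<Max A}" and BR: "\<forall>x\<in>B. poly (pderiv (legendre_poly p)) x = 0"
    unfolding A(2) by auto
  have B_R: "B \<subseteq> R" using BR by (auto simp: R_def)
  have ne: "pderiv (legendre_poly p) \<noteq> 0"
    using assms(1) by (simp add: pderiv_eq_0_iff degree_legendre)
  show fin: "finite R" unfolding R_def by (rule poly_roots_finite[OF ne])
  have "card R \<le> p - 1"
    using card_poly_roots_bound[OF ne] by (simp add: R_def degree_pderiv degree_legendre)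
  then have "B = R" using B B_R fin by (intro card_seteq) auto
  moreover have "Min A \<in> A" "Max A \<in> A" using A(1) \<open>A \<noteq> {}\<close> by auto
  ultimately show "card R = p - 1" "R \<subseteq> {-1<..<1}"
    using A(3) B by (auto simp: subset_iff) force+
qed

text \<open>Repeated integration by parts moves the derivatives in Rodrigues' formula onto
  \<open>h\<close>, without boundary terms by \<open>rodrigues_endpoint\<close>.\<close>

lemma legendre_orthogonal:
  assumes "degree h < n"
  shows "integral {-1..1} (poly (legendre_poly n * h)) = 0"
proof -
  \<comment> \<open>The exponent \<open>n\<close> stays fixed while the number \<open>k\<close> of
    derivatives varies, which makes induction possible.\<close>
  have "integral {-1..1} (poly ((pderiv ^^ k) (x2m1 ^ n) * h)) = 0" if "k \<le> n" "degree h < k" for k h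
    using that
  proof (induction k arbitrary: h)
    case (Suc k)
    have "integral {-1..1} (poly ((pderiv ^^ Suc k) (x2m1 ^ n) * h))
        = - integral {-1..1} (poly ((pderiv ^^ k) (x2m1 ^ n) * pderiv h))"
      using Suc.prems rodrigues_endpoint[of k n]
      by (simp only: funpow.simps o_apply, intro integral_poly_by_parts) auto
    also have "\<dots> = 0"
    \<comment> \<open>For constant \<open>h\<close> the degree does not drop, so the induction
      hypothesis may not apply; but then \<open>pderiv h\<close> is zero.\<close>
    proof (cases "degree h = 0")
      case True
      then show ?thesis by (simp add: pderiv_eq_0_iff[THEN iffD2])
    next
      case False
      then show ?thesis
        using Suc.IH[of "pderiv h"] Suc.prems by (simp add: degree_pderiv del: poly_mult)
    qed
    finally show ?case .
  qed simp
  from this[of n h] assms show ?thesis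
    by (simp only: legendre_poly_def mult_smult_left integral_poly_smult mult_zero_right order_refl)
qed

text \<open>The \<open>p - 1\<close> zeros of the derivative lie strictly inside the interval, so
  the two endpoints are new and become the first and last node.\<close>

lemma
  assumes "p \<ge> 1"
  shows set_gll_nodes: "set (gll_nodes p) = {-1, 1} \<union> {\<xi>. poly (pderiv (legendre_poly p)) \<xi> = 0}"
    and length_gll_nodes: "length (gll_nodes p) = Suc p"
    and sorted_gll_nodes: "sorted_wrt (<) (gll_nodes p)"
    and distinct_gll_nodes: "distinct (gll_nodes p)"
    and gll_nodes_first: "gll_nodes p ! 0 = -1"
    and gll_nodes_last: "gll_nodes p ! p = 1"
proof -
  note R = legendre_deriv_roots[OF assms]
  let ?R = "{\<xi>. poly (pderiv (legendre_poly p)) \<xi> = 0}"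
  \<comment> \<open>\<open>sorted_list_of_set\<close> lists the elements of a set only if it is
    finite.\<close>
  have fin: "finite ({-1, 1} \<union> ?R)" using R by simp
  then show set: "set (gll_nodes p) = {-1, 1} \<union> ?R"
    unfolding gll_nodes_def by (rule set_sorted_list_of_set)
  have "card ({-1, 1} \<union> ?R) = Suc p"
    using R assms by (subst card_Un_disjoint) auto
  then show len: "length (gll_nodes p) = Suc p"
    unfolding gll_nodes_def by (simp only: length_sorted_list_of_set)
  show sorted: "sorted_wrt (<) (gll_nodes p)"
    unfolding gll_nodes_def by (rule strict_sorted_list_of_set)
  show "distinct (gll_nodes p)"
    unfolding gll_nodes_def by (rule distinct_sorted_list_of_set)
  have bounds: "-1 \<le> gll_nodes p ! i \<and> gll_nodes p ! i \<le> 1" if "i \<le> p" for i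
  proof -
    have "gll_nodes p ! i \<in> set (gll_nodes p)" using len that by (intro nth_mem) auto
    then show ?thesis unfolding set using R(3) by auto
  qed
  have mono: "gll_nodes p ! i \<le> gll_nodes p ! j" if "i \<le> j" "j \<le> p" for i j
    using sorted len that by (cases "i = j") (auto simp: sorted_wrt_iff_nth_less intro!: less_imp_le)
  obtain i where "i \<le> p" "gll_nodes p ! i = -1"
    using set len by (metis UnI1 in_set_conv_nth insertI1 less_Suc_eq_le)
  then show "gll_nodes p ! 0 = -1" using mono[of 0 i] bounds[of 0] by auto
  obtain i where "i \<le> p" "gll_nodes p ! i = 1"
    using set len by (metis UnI1 in_set_conv_nth insertI1 insertI2 less_Suc_eq_le)
  then show "gll_nodes p ! p = 1" using mono[of i p] bounds[of p] by auto
qed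

section \<open>Exactness of the quadrature and positivity of its weights\<close>

definition gll_quad :: "nat \<Rightarrow> real poly \<Rightarrow> real" where
  "gll_quad p f = (\<Sum>i\<le>p. gll_weight p i * poly f (gll_nodes p ! i))"

text \<open>For \<open>p \<ge> 1\<close>, a scalar multiple of the node polynomial of the
  quadrature.\<close>

definition gll_poly :: "nat \<Rightarrow> real poly" where
  "gll_poly p = x2m1 * pderiv (legendre_poly p)"

lemma degree_gll_poly: "p \<ge> 1 \<Longrightarrow> degree (gll_poly p) = Suc p"
  by (subst gll_poly_def, subst degree_mult_eq)
    (auto simp: degree_pderiv degree_legendre pderiv_eq_0_iff)

lemma gll_quad_diff: "gll_quad p (f - g) = gll_quad p f - gll_quad p g"
  by (simp add: gll_quad_def sum_subtractf right_diff_distrib)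

lemma gll_quad_multiple: "p \<ge> 1 \<Longrightarrow> gll_quad p (gll_poly p * g) = 0"
proof (unfold gll_quad_def, rule sum.neutral, rule ballI)
  fix i assume "p \<ge> 1" "i \<in> {..p}"
  then have "gll_nodes p ! i \<in> set (gll_nodes p)"
    by (intro nth_mem) (auto simp: length_gll_nodes)
  then have "poly (gll_poly p) (gll_nodes p ! i) = 0"
    using \<open>p \<ge> 1\<close> by (auto simp: set_gll_nodes gll_poly_def)
  then show "gll_weight p i * poly (gll_poly p * g) (gll_nodes p ! i) = 0" by simp
qed

text \<open>In integration by parts the factor \<open>x2m1\<close> removes the boundary terms and
  leaves the Legendre polynomial against a polynomial of degree below \<open>p\<close>.\<close>

lemma integral_gll_poly_multiple:
  assumes "degree g + 2 \<le> p"
  shows "integral {-1..1} (poly (gll_poly p * g)) = 0"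
proof -
  have "degree (pderiv (x2m1 * g)) < p"
    using assms degree_mult_le[of x2m1 g] by (simp add: degree_pderiv)
  then have "integral {-1..1} (poly (legendre_poly p * pderiv (x2m1 * g))) = 0"
    by (rule legendre_orthogonal)
  moreover have "integral {-1..1} (poly (pderiv (legendre_poly p) * (x2m1 * g)))
      = - integral {-1..1} (poly (legendre_poly p * pderiv (x2m1 * g)))"
    by (intro integral_poly_by_parts) auto
  moreover have "pderiv (legendre_poly p) * (x2m1 * g) = gll_poly p * g"
    by (simp only: gll_poly_def mult.assoc mult.left_commute)
  ultimately show ?thesis by simp
qed

text \<open>The weights are the integrals of the Lagrange basis, so the rule integrates the
  interpolant, here \<open>f\<close> itself.\<close>

lemma gll_quad_exact_low:
  assumes "p \<ge> 1" "degree f \<le> p"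
  shows "gll_quad p f = integral {-1..1} (poly f)"
  by (subst (2) lagrange_interpolation[OF distinct_gll_nodes length_gll_nodes assms(2)])
    (simp_all only: assms integral_poly_sum finite_atMost integral_poly_smult gll_quad_def gll_weight_def mult.commute)

text \<open>After division by \<open>gll_poly p\<close>, the multiple contributes zero to both
  quadrature and integral, and the remainder has degree at most \<open>p\<close>.\<close>

lemma gll_quad_exact:
  assumes p: "p \<ge> 1" and f: "degree f < 2 * p"
  shows "gll_quad p f = integral {-1..1} (poly f)"
proof -
  let ?g = "f div gll_poly p" and ?r = "f mod gll_poly p"
  have eq: "f - gll_poly p * ?g = ?r"
    by (simp add: minus_mult_div_eq_mod)
  have N0: "gll_poly p \<noteq> 0" using degree_gll_poly[OF p] by auto
  have r: "degree ?r \<le> p"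
    using degree_mod_less[OF N0, of f] degree_gll_poly[OF p] by auto
  have I: "integral {-1..1} (poly (gll_poly p * ?g)) = 0"
  proof (cases "?g = 0")
    case False
    then have "degree (gll_poly p * ?g) = Suc p + degree ?g"
      using N0 by (simp add: degree_mult_eq degree_gll_poly[OF p])
    \<comment> \<open>As the remainder has degree at most \<open>p\<close>, this forces
      \<open>p + 1 + degree ?g\<close> to be at most \<open>2 * p - 1\<close>, the bound required on
      the quotient.\<close>
    moreover have "degree (gll_poly p * ?g) \<le> max (degree f) (degree ?r)"
      using degree_diff_le_max[of f ?r] eq by (metis add_diff_cancel_left' diff_add_cancel)
    ultimately show ?thesis
      using f r by (intro integral_gll_poly_multiple) auto
  qed simp
  have "gll_quad p f = gll_quad p ?r"
    using gll_quad_diff[of p f "gll_poly p * ?g"] gll_quad_multiple[OF p, of ?g] eq by simp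
  also have "\<dots> = integral {-1..1} (poly ?r)" by (rule gll_quad_exact_low[OF p r])
  also have "\<dots> = integral {-1..1} (poly (gll_poly p * ?g + ?r))"
    by (simp only: integral_poly_add I)
  finally show ?thesis by (simp add: mult_div_mod_eq)
qed

text \<open>
  The squared basis polynomial has degree \<open>2 p\<close>, just beyond exactness. Subtracting a
  multiple of \<open>(x\<^sup>2 - 1) P' * P'\<close>, which vanishes at the nodes and has nonpositive integral,
  removes its leading term.
\<close>

lemma gll_weight_pos:
  assumes p: "p \<ge> 1" and i: "i \<le> p"
  shows "gll_weight p i > 0"
proof -
  note nodes = distinct_gll_nodes[OF p] length_gll_nodes[OF p]
  let ?l = "lagrange_basis p (gll_nodes p) i" and ?P = "pderiv (legendre_poly p)"
  let ?G = "gll_poly p * ?P"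
  have dl: "degree ?l = p" by (rule degree_lagrange_basis[OF nodes i])
  have l1: "poly ?l (gll_nodes p ! i) = 1" using poly_lagrange_basis[OF nodes i i] by simp
  have l0: "?l \<noteq> 0" using l1 by auto
  have P0: "?P \<noteq> 0" and dP: "degree ?P = p - 1"
    using p by (simp_all add: pderiv_eq_0_iff degree_legendre degree_pderiv)
  \<comment> \<open>This ratio matches the leading coefficients of \<open>?l * ?l\<close> and
    \<open>c\<close> times \<open>?G\<close>; being a square, it is nonnegative.\<close>
  define c where "c = (lead_coeff ?l / lead_coeff ?P)\<^sup>2"
  have "degree (gll_poly p) \<noteq> 0" by (simp add: degree_gll_poly[OF p])
  then have "gll_poly p \<noteq> 0" by auto
  then have G: "degree ?G = 2 * p"
    using p P0 by (simp add: degree_mult_eq degree_gll_poly dP)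
  have "lead_coeff (gll_poly p) = lead_coeff ?P"
    unfolding gll_poly_def lead_coeff_mult by simp
  then have lcG: "lead_coeff ?G = (lead_coeff ?P)\<^sup>2"
    unfolding lead_coeff_mult by (simp add: power2_eq_square)
  have sq: "degree (?l * ?l) = 2 * p"
    using l0 dl by (simp add: degree_mult_eq)
  have lcsq: "lead_coeff (?l * ?l) = (lead_coeff ?l)\<^sup>2"
    by (simp only: lead_coeff_mult power2_eq_square)
  have "degree (?l * ?l - Polynomial.smult c ?G) < 2 * p"
  proof -
    have "coeff (?l * ?l - Polynomial.smult c ?G) (2 * p) = 0"
      using sq lcsq G lcG P0 by (simp add: c_def power_divide)
    moreover have "degree (?l * ?l - Polynomial.smult c ?G) \<le> 2 * p"
      using sq G by (intro degree_diff_le) (auto intro: order.trans[OF degree_smult_le])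
    ultimately show ?thesis
      using eq_zero_or_degree_less p by fastforce
  qed
  then have "gll_quad p (?l * ?l - Polynomial.smult c ?G)
      = integral {-1..1} (poly (?l * ?l - Polynomial.smult c ?G))"
    by (rule gll_quad_exact[OF p])
  also have "?l * ?l - Polynomial.smult c ?G = ?l * ?l + Polynomial.smult c (- ?G)" by simp
  also have "integral {-1..1} (poly (?l * ?l + Polynomial.smult c (- ?G)))
      = integral {-1..1} (poly (?l * ?l)) + c * integral {-1..1} (poly (- ?G))"
    by (simp only: integral_poly_add integral_poly_smult)
  also have "\<dots> > 0"
  proof -
    have "integral {-1..1} (poly (- ?G)) \<ge> 0"
    proof (intro integral_nonneg poly_integrable)
      fix x :: real assume "x \<in> {-1..1}"
      then have "(1 - x * x) * (poly ?P x * poly ?P x) \<ge> 0"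
        by (intro mult_nonneg_nonneg[OF _ zero_le_square]) (auto simp: abs_square_le_1[unfolded power2_eq_square])
      then show "poly (- ?G) x \<ge> 0" by (simp add: gll_poly_def algebra_simps)
    qed
    moreover have "integral {-1..1} (poly (?l * ?l)) \<ge> 0"
      by (intro integral_nonneg poly_integrable) auto
    moreover have "gll_nodes p ! i \<in> {-1..1}"
      using nth_mem[of i "gll_nodes p"] nodes(2) i set_gll_nodes[OF p] legendre_deriv_roots(3)[OF p] by auto
    \<comment> \<open>The integrand is continuous and nonnegative, and equals 1 at the node
      \<open>i\<close>.\<close>
    then have "integral {-1..1} (poly (?l * ?l)) \<noteq> 0"
      using l1 by (subst integral_eq_0_iff) (auto intro!: continuous_intros bexI[of _ "gll_nodes p ! i"])
    moreover have "c \<ge> 0" by (simp add: c_def)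
    ultimately show ?thesis by (intro add_pos_nonneg mult_nonneg_nonneg) auto
  qed
  finally have "gll_quad p (?l * ?l - Polynomial.smult c ?G) > 0" by simp
  also have "gll_quad p (?l * ?l - Polynomial.smult c ?G) = gll_quad p (?l * ?l)"
    using gll_quad_multiple[OF p, of "Polynomial.smult c ?P"] by (simp add: gll_quad_diff)
  also have "\<dots> = (\<Sum>k\<le>p. if k = i then gll_weight p k else 0)"
    unfolding gll_quad_def by (intro sum.cong) (auto simp: poly_lagrange_basis[OF nodes i])
  finally show ?thesis using i by simp
qed

text \<open>The derivative of \<open>l i * l j\<close> has degree below \<open>2 * p\<close>, so its
  quadrature is exact and gives the boundary values, which are Kronecker symbols because the
  endpoints are nodes. Quadrature against \<open>l i\<close> picks out node
  \<open>i\<close>.\<close>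

lemma gll_summation_by_parts:
  assumes p: "p \<ge> 1" and i: "i \<le> p" and j: "j \<le> p"
  defines "l \<equiv> lagrange_basis p (gll_nodes p)"
  shows "gll_weight p i * poly (pderiv (l j)) (gll_nodes p ! i)
       + gll_weight p j * poly (pderiv (l i)) (gll_nodes p ! j)
       = (if i = p \<and> j = p then 1 else 0) - (if i = 0 \<and> j = 0 then 1 else 0)"
proof -
  note nodes = distinct_gll_nodes[OF p] length_gll_nodes[OF p]
  have quad_basis: "gll_quad p (l i * f) = gll_weight p i * poly f (gll_nodes p ! i)" if "i \<le> p" for i f
  proof -
    have "gll_quad p (l i * f) = (\<Sum>k\<le>p. if k = i then gll_weight p k * poly f (gll_nodes p ! k) else 0)"
      unfolding gll_quad_def l_def by (intro sum.cong) (auto simp: poly_lagrange_basis[OF nodes that])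
    then show ?thesis using that by simp
  qed
  have "degree (pderiv (l i * l j)) < 2 * p"
    using degree_mult_le[of "l i" "l j"] p
    by (simp add: l_def degree_pderiv degree_lagrange_basis[OF nodes] i j)
  then have "gll_quad p (pderiv (l i * l j)) = integral {-1..1} (poly (pderiv (l i * l j)))"
    by (rule gll_quad_exact[OF p])
  also have "\<dots> = poly (l i * l j) (gll_nodes p ! p) - poly (l i * l j) (gll_nodes p ! 0)"
    by (simp add: integral_poly_pderiv gll_nodes_first[OF p] gll_nodes_last[OF p] del: poly_mult)
  finally have "gll_quad p (l i * pderiv (l j) + l j * pderiv (l i)) = \<dots>"
    by (simp add: pderiv_mult)
  moreover have "gll_quad p (l i * pderiv (l j) + l j * pderiv (l i))
      = gll_quad p (l i * pderiv (l j)) + gll_quad p (l j * pderiv (l i))"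
    by (simp add: gll_quad_def distrib_left sum.distrib)
  moreover have "poly (l i * l j) (gll_nodes p ! p) = (if i = p \<and> j = p then 1 else 0)"
    "poly (l i * l j) (gll_nodes p ! 0) = (if i = 0 \<and> j = 0 then 1 else 0)"
    using i j by (auto simp: l_def poly_lagrange_basis[OF nodes])
  ultimately show ?thesis
    by (simp only: quad_basis[OF i] quad_basis[OF j])
qed

section \<open>DGSEM operators\<close>

lemma dgsem_boundary_nodes:
  assumes p: "p \<ge> 1" and ab: "a < b"
  shows "boundary_nodes a b (dgsem_nodes p a b)"
proof -
  have ne: "dgsem_nodes p a b \<noteq> []" "gll_nodes p \<noteq> []"
    using length_gll_nodes[OF p] by (auto simp: dgsem_nodes_def)
  have "sorted_wrt (<) (dgsem_nodes p a b)"
    unfolding dgsem_nodes_def sorted_wrt_map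
    by (rule sorted_wrt_mono_rel[OF _ sorted_gll_nodes[OF p]]) (use ab in auto)
  moreover have "hd (dgsem_nodes p a b) = a" "last (dgsem_nodes p a b) = b"
    using length_gll_nodes[OF p] gll_nodes_first[OF p] gll_nodes_last[OF p] ne
    by (auto simp: dgsem_nodes_def hd_map last_map hd_conv_nth last_conv_nth field_simps)
  ultimately show ?thesis
    using p by (simp add: boundary_nodes_def dgsem_nodes_def length_gll_nodes)
qed

text \<open>By the chain rule, the half-length of the element turns its derivative matrix into the
  one on the reference interval.\<close>

lemma dgsem_deriv_index:
  assumes p: "p \<ge> 1" and ab: "a < b" and i: "i \<le> p" and j: "j \<le> p"
  shows "(b - a) / 2 * dgsem_deriv p a b $$ (i, j)
       = poly (pderiv (lagrange_basis p (gll_nodes p) j)) (gll_nodes p ! i)"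
proof -
  define h where "h = (b - a) / 2"
  have h: "h \<noteq> 0" using ab by (simp add: h_def)
  let ?xs = "dgsem_nodes p a b"
  have xs: "?xs = map (\<lambda>\<xi>. a + h * (\<xi> + 1)) (gll_nodes p)"
    by (simp add: dgsem_nodes_def h_def)
  have "lagrange_basis p (gll_nodes p) j = pcompose (lagrange_basis p ?xs j) [:a + h, h:]"
    unfolding xs by (rule lagrange_basis_affine[OF h length_gll_nodes[OF p] j, symmetric])
  then have "pderiv (lagrange_basis p (gll_nodes p) j)
      = pcompose (pderiv (lagrange_basis p ?xs j)) [:a + h, h:] * [:h:]"
    by (simp add: pderiv_pcompose pderiv_pCons)
  moreover have "?xs ! i = a + h + gll_nodes p ! i * h"
    using i length_gll_nodes[OF p] by (simp add: xs algebra_simps)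
  ultimately show ?thesis
    using i j by (simp add: dgsem_deriv_def poly_pcompose h_def[symmetric] mult.commute)
qed

lemma dgsem_diagonal_norm_sbp:
  assumes p: "p \<ge> 1" and ab: "a < b"
  shows "diagonal_norm_sbp (Suc p) (dgsem_deriv p a b) (dgsem_mass p a b)"
proof -
  let ?D = "dgsem_deriv p a b" and ?M = "dgsem_mass p a b"
  have D: "?D \<in> carrier_mat (Suc p) (Suc p)" and M: "?M \<in> carrier_mat (Suc p) (Suc p)"
    by (auto simp: dgsem_deriv_def dgsem_mass_def mat_diag_def)
  \<comment> \<open>The half-length in the mass matrix cancels the scaling of the derivative, so
    \<open>?M * ?D\<close> is the same on every element.\<close>
  have MD: "(?M * ?D) $$ (i, j) = gll_weight p i * poly (pderiv (lagrange_basis p (gll_nodes p) j)) (gll_nodes p ! i)"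
    if "i \<le> p" "j \<le> p" for i j
    using that D dgsem_deriv_index[OF p ab that]
    by (auto simp: dgsem_mass_def mat_diag_mult_left[of _ "Suc p" "Suc p"])
  let ?B = "outer_prod (trace_R (Suc p)) (trace_R (Suc p)) - outer_prod (trace_L (Suc p)) (trace_L (Suc p))"
  have "?M * ?D + (?M * ?D)\<^sup>T = ?B"
  proof (rule eq_matI)
    fix i j
    assume "i < dim_row ?B"
      "j < dim_col ?B"
    then have ij: "i \<le> p" "j \<le> p" by (auto simp: outer_prod_def trace_L_def)
    then have "(?M * ?D + (?M * ?D)\<^sup>T) $$ (i, j) = (?M * ?D) $$ (i, j) + (?M * ?D) $$ (j, i)"
      using D M by auto
    also have "\<dots> = (if i = p \<and> j = p then 1 else 0) - (if i = 0 \<and> j = 0 then 1 else 0)"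
      using MD ij gll_summation_by_parts[OF p ij] by simp
    finally show "(?M * ?D + (?M * ?D)\<^sup>T) $$ (i, j)
        = ?B $$ (i, j)"
      using ij by (auto simp: outer_prod_def trace_L_def trace_R_def unit_vec_def)
  qed (use D M in \<open>auto simp: outer_prod_def trace_L_def\<close>)
  moreover have "diagonal_mat ?M" "\<forall>i<Suc p. ?M $$ (i, i) > 0"
    using ab gll_weight_pos[OF p] by (auto simp: diagonal_mat_def dgsem_mass_def mat_diag_def)
  ultimately show ?thesis
    using D M by (simp add: diagonal_norm_sbp_def)
qed

lemma dgsem_sbp_discretization:
  assumes "p \<ge> 1" "K \<ge> 1" "\<forall>e\<in>{1..K}. x e < x (e + 1)" "Tr > 0"
  shows "sbp_discretization (dgsem p K x c Tr)"
  using assms dgsem_boundary_nodes[OF assms(1)] dgsem_diagonal_norm_sbp[OF assms(1)]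
  by (simp add: sbp_discretization_def dgsem_def elems_def nnodes_def dgsem_nodes_def length_gll_nodes)

theorem theorem2p1:
  shows "(\<forall>S. sbp_discretization S \<longrightarrow>
            gradient_uniquely_determined S \<and> gradient_locally_computable S) \<and>
         (\<forall>(p::nat) (K::nat) (x :: nat \<Rightarrow> real) (c :: boundary_condition) (Tr :: real).
            p \<ge> 1 \<and> K \<ge> 1 \<and> (\<forall>e\<in>{1..K}. x e < x (e + 1)) \<and> Tr > 0 \<longrightarrow>
            sbp_discretization (dgsem p K x c Tr) \<and>
            gradient_uniquely_determined (dgsem p K x c Tr) \<and>
            gradient_locally_computable (dgsem p K x c Tr))"
  using sbp_gradient_uniquely_determined sbp_gradient_locally_computable
    dgsem_sbp_discretization
  by blast

end
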